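(* For every positive integer $m$, $g(2,m) = m+1$.
   Context: Fix positive integers $n,m$ and write $[m]=\{1,\ldots,m\}$. Let $\mathcal{F}=\{C_1,\ldots,C_k\}$ be a multiset of non-empty subsets of $[m]$ (repetitions allowed; the members are indexed by $[k]$). A resolution of $\mathcal{F}$ into $n$ classes is a partition $\{A_1,\ldots,A_n\}$ of the index set $[k]$ into $n$ blocks such that for each $i\in[n]$ the sets $C_j$, $j\in A_i$, are pairwise disjoint and their union is $[m]$. $\mathcal{F}$ is uniquely resolvable (with respect to $(n,m)$) if it has exactly one such resolution, where partitions of $[k]$ are regarded as unordered (two resolutions differing only by relabeling the blocks are the same). $g(n,m)$ denotes the maximum size $k$ of a uniquely resolvable multiset with respect to $(n,m)$. *)

theory Defs
  imports Main "HOL-Library.Disjoint_Sets"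
begin

text \<open>A multiset of \<open>k\<close> sets is given by an indexed family \<open>C 1, \<dots>, C k\<close>; only the values
  of \<open>C\<close> on \<open>{1..k}\<close> matter. Partitions are taken of the index set \<open>{1..k}\<close>, so equal members
  with different indices are distinguished.\<close>

definition set_family :: "nat \<Rightarrow> nat \<Rightarrow> (nat \<Rightarrow> nat set) \<Rightarrow> bool" where
  "set_family m k C \<longleftrightarrow> (\<forall>j\<in>{1..k}. C j \<noteq> {} \<and> C j \<subseteq> {1..m})"

definition resolution :: "nat \<Rightarrow> nat \<Rightarrow> nat \<Rightarrow> (nat \<Rightarrow> nat set) \<Rightarrow> nat set set \<Rightarrow> bool" where
  "resolution n m k C P \<longleftrightarrow>
     partition_on {1..k} P \<and> card P = n \<and>
     (\<forall>A\<in>P. disjoint_family_on C A \<and> (\<Union>j\<in>A. C j) = {1..m})"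

definition uniquely_resolvable :: "nat \<Rightarrow> nat \<Rightarrow> nat \<Rightarrow> (nat \<Rightarrow> nat set) \<Rightarrow> bool" where
  "uniquely_resolvable n m k C \<longleftrightarrow> set_family m k C \<and> (\<exists>!P. resolution n m k C P)"

text \<open>For positive \<open>n\<close> and \<open>m\<close> the maximum ranges over a finite non-empty set: each of the \<open>n\<close>
  classes has at most \<open>m\<close> members, and \<open>n\<close> copies of \<open>{1..m}\<close> are uniquely resolvable.\<close>

definition g :: "nat \<Rightarrow> nat \<Rightarrow> nat" where
  "g n m = Max {k. \<exists>C. uniquely_resolvable n m k C}"

end

theory Submission
  imports Defs
begin

text \<open>Fix a resolution into classes \<open>A\<close> and \<open>B\<close>. Every point \<open>x\<close> lies in exactly one member
  of each class, so it is an edge of a bipartite multigraph on the index set with \<open>k\<close> vertices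
  and \<open>m\<close> edges, and resolutions are exactly its proper 2-colourings. The colouring is unique
  iff the graph is connected, because otherwise one component can be recoloured. A connected
  graph has at most one more vertex than edges, and a path with \<open>m\<close> edges attains this
  bound.\<close>

definition exact_cover :: "nat \<Rightarrow> (nat \<Rightarrow> nat set) \<Rightarrow> nat set \<Rightarrow> bool" where
  "exact_cover m C A \<longleftrightarrow> disjoint_family_on C A \<and> (\<Union>j\<in>A. C j) = {1..m}"

text \<open>Pointwise form: each point selects exactly one index from a class. Given two classes,
  this makes the point an edge with one end in each.\<close>

lemma exact_cover_iff:
  "exact_cover m C A \<longleftrightarrow>
     (\<forall>j\<in>A. C j \<subseteq> {1..m}) \<and> (\<forall>x\<in>{1..m}. \<exists>!j. j \<in> A \<and> x \<in> C j)"
proof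
  assume "exact_cover m C A"
  then have d: "disjoint_family_on C A" and u: "(\<Union>j\<in>A. C j) = {1..m}"
    unfolding exact_cover_def by simp_all
  have "\<exists>!j. j \<in> A \<and> x \<in> C j" if x: "x \<in> {1..m}" for x
  proof -
    from x[folded u] obtain j where j: "j \<in> A" "x \<in> C j" by (rule UN_E)
    show ?thesis
    proof (rule ex1I)
      fix i assume "i \<in> A \<and> x \<in> C i"
      then show "i = j" using j disjoint_family_onD[OF d, of i j] by (meson disjoint_iff)
    qed (use j in simp)
  qed
  then show "(\<forall>j\<in>A. C j \<subseteq> {1..m}) \<and> (\<forall>x\<in>{1..m}. \<exists>!j. j \<in> A \<and> x \<in> C j)"
    unfolding u[symmetric] by (simp add: UN_upper)
next
  assume r: "(\<forall>j\<in>A. C j \<subseteq> {1..m}) \<and> (\<forall>x\<in>{1..m}. \<exists>!j. j \<in> A \<and> x \<in> C j)"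
  have "(\<Union>j\<in>A. C j) = {1..m}"
  proof (intro equalityI UN_least subsetI)
    fix x assume "x \<in> {1..m}"
    then obtain j where "j \<in> A" "x \<in> C j" using r by (meson ex1_implies_ex)
    then show "x \<in> (\<Union>j\<in>A. C j)" by (rule UN_I)
  qed (use r in blast)
  moreover have "disjoint_family_on C A"
    unfolding disjoint_family_on_def
  proof (intro ballI impI)
    fix i j assume ij: "i \<in> A" "j \<in> A" "i \<noteq> j"
    have "x \<notin> C j" if "x \<in> C i" for x
    proof -
      have "x \<in> {1..m}" using r ij that by (meson subsetD)
      then show ?thesis using r ij that by metis
    qed
    then show "C i \<inter> C j = {}" by (simp add: disjoint_iff)
  qed
  ultimately show "exact_cover m C A" by (simp add: exact_cover_def)
qed

lemma resolution_2_iff: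
  assumes "m > 0"
  shows "resolution 2 m k C P \<longleftrightarrow>
    (\<exists>A B. P = {A, B} \<and> A \<union> B = {1..k} \<and> A \<inter> B = {} \<and> exact_cover m C A \<and> exact_cover m C B)"
    (is "_ \<longleftrightarrow> ?R")
proof
  assume "resolution 2 m k C P"
  then have p: "partition_on {1..k} P" and c: "card P = 2"
    and e: "\<forall>A\<in>P. exact_cover m C A"
    unfolding resolution_def exact_cover_def by simp_all
  obtain A B where AB: "P = {A, B}" "A \<noteq> B" using c by (auto simp: card_2_iff)
  have "A \<union> B = {1..k}" using partition_onD1[OF p] AB by auto
  moreover have "A \<inter> B = {}" using partition_onD2[OF p] AB by (auto simp: disjoint_def)
  moreover have "exact_cover m C A" "exact_cover m C B" using e AB by simp_all
  ultimately show ?R using AB(1) by (intro exI[of _ A] exI[of _ B] conjI)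
next
  assume ?R
  then obtain A B where P: "P = {A, B}" and u: "A \<union> B = {1..k}" and d: "A \<inter> B = {}"
    and e: "exact_cover m C A" "exact_cover m C B" by blast
  \<comment> \<open>Positivity of \<open>m\<close> is needed here: an empty class covers no point.
    Disjoint non-empty blocks are distinct, which gives cardinality 2.\<close>
  have ne: "A \<noteq> {}" "B \<noteq> {}" using e assms by (auto simp: exact_cover_def)
  then have "A \<noteq> B" using d by auto
  moreover have "partition_on {1..k} P"
    unfolding partition_on_def disjoint_def P using u d ne by (simp add: Int_commute)
  ultimately show "resolution 2 m k C P"
    using P e by (simp add: resolution_def exact_cover_def)
qed

text \<open>Recolouring on \<open>S\<close>. By \<open>closed\<close>, the two ends of each edge lie
  both inside \<open>S\<close> or both outside it, so exchanging the classes on \<open>S\<close>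
  still leaves exactly one end in the new class.\<close>

lemma exact_cover_switch:
  assumes A: "exact_cover m C A" and B: "exact_cover m C B"
    and closed: "\<And>i j. i \<in> A \<Longrightarrow> j \<in> B \<Longrightarrow> C i \<inter> C j \<noteq> {} \<Longrightarrow> i \<in> S \<longleftrightarrow> j \<in> S"
  shows "exact_cover m C (A - S \<union> B \<inter> S)"
  unfolding exact_cover_iff
proof (intro conjI ballI)
  fix j assume "j \<in> A - S \<union> B \<inter> S"
  then show "C j \<subseteq> {1..m}" using A B unfolding exact_cover_iff by blast
next
  fix x assume x: "x \<in> {1..m}"
  have ex1: "\<exists>!j. j \<in> A \<and> x \<in> C j" "\<exists>!j. j \<in> B \<and> x \<in> C j"
    using A B x unfolding exact_cover_iff by simp_all
  then obtain a b where ab: "a \<in> A" "x \<in> C a" "b \<in> B" "x \<in> C b" by metis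
  then have iff: "a \<in> S \<longleftrightarrow> b \<in> S" using closed[of a b] by (meson disjoint_iff)
  show "\<exists>!j. j \<in> A - S \<union> B \<inter> S \<and> x \<in> C j"
  proof (rule ex1I[of _ "if a \<in> S then b else a"])
    show "(if a \<in> S then b else a) \<in> A - S \<union> B \<inter> S \<and> x \<in> C (if a \<in> S then b else a)"
      using ab iff by simp
  next
    fix j assume j: "j \<in> A - S \<union> B \<inter> S \<and> x \<in> C j"
    then have "j \<in> A \<and> j \<notin> S \<and> j = a \<or> j \<in> B \<and> j \<in> S \<and> j = b"
      using ab ex1 by (metis Diff_iff IntE UnE)
    then show "j = (if a \<in> S then b else a)" using iff by metis
  qed
qed

text \<open>Connectedness stated without paths: no proper non-empty vertex set is closed under
  adjacency. Recolouring on \<open>S\<close> gives a resolution again, so by uniqueness it either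
  fixes both classes, forcing \<open>S\<close> to be empty, or exchanges them, forcing
  \<open>S\<close> to be everything.\<close>

lemma uniquely_resolvable_2_connected:
  assumes "m > 0" and P: "\<exists>!P. resolution 2 m k C P"
    and S: "S \<subseteq> {1..k}" "S \<noteq> {}"
    and closed: "\<And>i j. i \<in> {1..k} \<Longrightarrow> j \<in> {1..k} \<Longrightarrow> C i \<inter> C j \<noteq> {} \<Longrightarrow> i \<in> S \<longleftrightarrow> j \<in> S"
  shows "S = {1..k}"
proof -
  obtain A B where r: "resolution 2 m k C {A, B}" and u: "A \<union> B = {1..k}" and d: "A \<inter> B = {}"
    and e: "exact_cover m C A" "exact_cover m C B"
    using P resolution_2_iff[OF assms(1)] by metis
  let ?A = "A - S \<union> B \<inter> S" and ?B = "B - S \<union> A \<inter> S"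
  have "exact_cover m C ?A" "exact_cover m C ?B"
    by (rule exact_cover_switch; use e u closed in blast)+
  moreover have "?A \<union> ?B = {1..k}" "?A \<inter> ?B = {}" using u d by blast+
  ultimately have "resolution 2 m k C {?A, ?B}"
    unfolding resolution_2_iff[OF assms(1)] by blast
  then have "{?A, ?B} = {A, B}" using P r by blast
  then have "?A = A \<and> ?B = B \<or> ?A = B \<and> ?B = A" by (simp add: doubleton_eq_iff)
  then show ?thesis
  proof
    assume "?A = A \<and> ?B = B"
    then have "S = {}" using S u d by blast
    then show ?thesis using S by blast
  next
    assume "?A = B \<and> ?B = A"
    then show ?thesis using S u d by blast
  qed
qed

lemma uniquely_resolvable_2_le:
  assumes "m > 0" and "uniquely_resolvable 2 m k C"
  shows "k \<le> m + 1"
proof -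
  have P: "\<exists>!P. resolution 2 m k C P" and f: "set_family m k C"
    using assms(2) by (auto simp: uniquely_resolvable_def)
  obtain A B where u: "A \<union> B = {1..k}" and e: "exact_cover m C A" "exact_cover m C B"
    using P resolution_2_iff[OF assms(1)] by metis
  have points: "x \<in> {1..m}" if "j \<in> {1..k}" "x \<in> C j" for j x
    using f that unfolding set_family_def by blast
  \<comment> \<open>Pigeonhole: among three distinct indices sharing a point, two would lie in the
    same class. Hence an edge has no ends beyond \<open>i\<close> and \<open>j\<close>.\<close>
  have two: "l = i \<or> l = j"
    if "i \<in> {1..k}" "j \<in> {1..k}" "l \<in> {1..k}" "i \<noteq> j" "x \<in> C i" "x \<in> C j" "x \<in> C l" for i j l x
  proof -
    have "x \<in> {1..m}" using points that by blast
    then have "\<exists>!j. j \<in> A \<and> x \<in> C j" "\<exists>!j. j \<in> B \<and> x \<in> C j"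
      using e unfolding exact_cover_iff by simp_all
    moreover have "i \<in> A \<or> i \<in> B" "j \<in> A \<or> j \<in> B" "l \<in> A \<or> l \<in> B" using u that by blast+
    ultimately show ?thesis using that by metis
  qed
  \<comment> \<open>\<open>E T\<close> is the set of edges of the graph with both ends in \<open>T\<close>.\<close>
  define E where "E T = {x\<in>{1..m}. \<forall>j\<in>{1..k}. x \<in> C j \<longrightarrow> j \<in> T}" for T
  \<comment> \<open>A spanning tree is grown one vertex at a time, and each new vertex brings at
    least one new edge.\<close>
  have grow: "\<exists>T. T \<subseteq> {1..k} \<and> card T = Suc t \<and> t \<le> card (E T)" if "Suc t \<le> k" for t
    using that
  proof (induction t)
    case 0
    then show ?case by (intro exI[of _ "{1}"]) auto
  next
    case (Suc t)
    then obtain T where T: "T \<subseteq> {1..k}" "card T = Suc t" "t \<le> card (E T)" by auto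
    have "T \<noteq> {}" using T by auto
    moreover have "T \<noteq> {1..k}" using T Suc.prems by auto
    \<comment> \<open>As \<open>T\<close> is not closed under adjacency, some edge leaves it; that
      edge becomes internal once its outer end \<open>j\<close> is added.\<close>
    ultimately obtain i j where ij: "i \<in> T" "j \<in> {1..k}" "j \<notin> T" "C i \<inter> C j \<noteq> {}"
      using uniquely_resolvable_2_connected[OF assms(1) P T(1)] T(1) by (metis Int_commute)
    then obtain x where x: "x \<in> C i" "x \<in> C j" by blast
    have "x \<in> {1..m}" using points[OF ij(2) x(2)] .
    then have "x \<in> E (insert j T)"
      unfolding E_def using two[of i j _ x] ij x T(1) by blast
    then have "insert x (E T) \<subseteq> E (insert j T)" by (auto simp: E_def)
    moreover have "x \<notin> E T" using ij x by (auto simp: E_def)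
    moreover have "finite (E S)" for S by (simp add: E_def)
    ultimately have "Suc (card (E T)) \<le> card (E (insert j T))"
      by (metis card_insert_disjoint card_mono)
    moreover have "card (insert j T) = Suc (Suc t)"
      using T ij by (simp add: finite_subset[OF T(1)])
    ultimately show ?case using T ij by (intro exI[of _ "insert j T"]) auto
  qed
  show ?thesis
  proof (cases k)
    case (Suc t)
    then obtain T where "t \<le> card (E T)" using grow by blast
    also have "\<dots> \<le> card {1..m}" by (rule card_mono) (auto simp: E_def)
    finally show ?thesis using Suc by simp
  qed simp
qed

text \<open>The path with vertices 1, ..., \<open>m + 1\<close>, in which edge \<open>x\<close>
  joins \<open>x\<close> and \<open>x + 1\<close>. Intersecting with \<open>{1..m}\<close> trims the
  end members to \<open>{1}\<close> and \<open>{m}\<close>.\<close>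

lemma uniquely_resolvable_2_path:
  assumes "m > 0"
  shows "uniquely_resolvable 2 m (m + 1) (\<lambda>j. {j - 1, j} \<inter> {1..m})"
proof -
  let ?C = "\<lambda>j. {j - 1, j} \<inter> {1..m}"
  let ?O = "{j\<in>{1..m + 1}. odd j}" and ?E = "{j\<in>{1..m + 1}. even j}"
  have cover: "exact_cover m ?C {j\<in>{1..m + 1}. odd j = b}" for b
    unfolding exact_cover_iff
  proof (intro conjI ballI)
    fix x assume x: "x \<in> {1..m}"
    show "\<exists>!j. j \<in> {j\<in>{1..m + 1}. odd j = b} \<and> x \<in> ?C j"
    \<comment> \<open>The two ends of edge \<open>x\<close> have opposite parity, so exactly one of
      them has parity \<open>b\<close>.\<close>
    proof (rule ex1I[of _ "if odd x = b then x else x + 1"])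
      fix j assume j: "j \<in> {j\<in>{1..m + 1}. odd j = b} \<and> x \<in> ?C j"
      then have "j = x \<or> j = x + 1" by auto
      then show "j = (if odd x = b then x else x + 1)" using j by auto
    qed (use x in auto)
  qed auto
  have "exact_cover m ?C ?O" "exact_cover m ?C ?E" using cover[of True] cover[of False] by simp_all
  moreover have "?O \<union> ?E = {1..m + 1}" "?O \<inter> ?E = {}" by auto
  ultimately have ex: "resolution 2 m (m + 1) ?C {?O, ?E}"
    unfolding resolution_2_iff[OF assms] by blast
  have unique: "P = {?O, ?E}" if "resolution 2 m (m + 1) ?C P" for P
  proof -
    \<comment> \<open>Blocks are unordered, so \<open>A\<close> may be taken to be the one
      containing 1.\<close>
    obtain A B where AB: "P = {A, B}" and u: "A \<union> B = {1..m + 1}" and d: "A \<inter> B = {}"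
      and e: "exact_cover m ?C A" "exact_cover m ?C B" and one: "1 \<in> A"
    proof -
      obtain A B where *: "P = {A, B}" "A \<union> B = {1..m + 1}" "A \<inter> B = {}"
        "exact_cover m ?C A" "exact_cover m ?C B"
        using \<open>resolution 2 m (m + 1) ?C P\<close> unfolding resolution_2_iff[OF assms] by blast
      have "1 \<in> A \<union> B" using *(2) by simp
      then show thesis
      proof
        assume "1 \<in> A"
        then show thesis using * that by simp
      next
        assume "1 \<in> B"
        moreover have "P = {B, A}" "B \<union> A = {1..m + 1}" "B \<inter> A = {}" using *(1-3) by blast+
        ultimately show thesis using *(4,5) that by simp
      qed
    qed
    have not_both: "\<not> (j \<in> X \<and> Suc j \<in> X)"
      if "exact_cover m ?C X" "j \<in> {1..m}" for j X
    proof
      assume "j \<in> X \<and> Suc j \<in> X"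
      moreover have "j \<in> ?C j" "j \<in> ?C (Suc j)" using that by auto
      moreover have "\<exists>!i. i \<in> X \<and> j \<in> ?C i" using that unfolding exact_cover_iff by blast
      ultimately show False by (metis n_not_Suc_n)
    qed
    \<comment> \<open>Neighbours on the path share the point \<open>j\<close>, so they lie in
      different blocks; the block of 1 then determines all others.\<close>
    have step: "Suc j \<in> A \<longleftrightarrow> j \<notin> A" if "j \<in> {1..m}" for j
    proof -
      have "j \<in> A \<union> B" "Suc j \<in> A \<union> B" using u that by auto
      then show ?thesis using not_both[OF e(1) that] not_both[OF e(2) that] by blast
    qed
    have parity: "Suc j \<in> A \<longleftrightarrow> odd (Suc j)" if "j \<le> m" for j
      using that
    proof (induction j)
      case (Suc j)
      then show ?case using step[of "Suc j"] by simp
    qed (use one in simp)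
    have "j \<in> A \<longleftrightarrow> odd j" if "j \<in> {1..m + 1}" for j
      using parity[of "j - 1"] that by (cases j) auto
    then have "A = ?O" "B = ?E" using u d by blast+
    then show ?thesis using AB by simp
  qed
  have "set_family m (m + 1) ?C"
    using assms by (auto simp: set_family_def)
  then show ?thesis
    unfolding uniquely_resolvable_def using ex unique by blast
qed

theorem theorem12:
  fixes m :: nat
  assumes "m > 0"
  shows "g 2 m = m + 1"
  unfolding g_def
proof (rule Max_eqI)
  show "finite {k. \<exists>C. uniquely_resolvable 2 m k C}"
    by (rule finite_subset[of _ "{..m + 1}"]) (use uniquely_resolvable_2_le[OF assms] in auto)
qed (use uniquely_resolvable_2_le[OF assms] uniquely_resolvable_2_path[OF assms] in blast)+

end
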